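(* The operator $I^R$ is not definable in $\mathcal{L}(I)$ over the class of all bi-frames $\langle S,R,R^\bullet\rangle$ satisfying the condition $R^\bullet\subseteq R$.
   Context: Language. Fix a nonempty set $\mathbf{P}$ of propositional variables. The formulas of the language $\mathbf{IRI}$ are given by $\varphi::=p\mid\neg\varphi\mid(\varphi\land\varphi)\mid I\varphi\mid I^R\varphi$ with $p\in\mathbf{P}$; other Boolean connectives are defined as usual. $\mathcal{L}(I)$ is the fragment of $\mathbf{IRI}$ without the construct $I^R\varphi$. Bi-semantics. A bi-frame is a triple $\langle S,R,R^\bullet\rangle$ with $S$ a nonempty set and $R,R^\bullet$ binary relations on $S$; a bi-model $\mathcal{M}=\langle S,R,R^\bullet,V\rangle$ is a bi-frame with a valuation $V:\mathbf{P}\to\mathcal{P}(S)$. Truth at $s\in S$: $\mathcal{M},s\vDash p$ iff $s\in V(p)$; $\neg,\land$ are interpreted classically; $\mathcal{M},s\vDash I\varphi$ iff there is $t$ with $sRt$ and $\mathcal{M},t\vDash\varphi$, and there is $u$ with $sRu$ and $\mathcal{M},u\nvDash\varphi$; $\mathcal{M},s\vDash I^R\varphi$ iff $\mathcal{M},s\vDash I\varphi$ and there is $t$ with $sR^\bullet t$ and $\mathcal{M},t\nvDash I\varphi$. Definability. $I^R$ is definable in $\mathcal{L}(I)$ over a class $F$ of bi-frames if for every $\varphi\in\mathcal{L}(I)$ there is $\psi\in\mathcal{L}(I)$ such that $I^R\varphi\leftrightarrow\psi$ is true at every state of every bi-model based on a bi-frame in $F$. *)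

theory Defs
  imports Main
begin

datatype 'p form =
    Atom 'p
  | Neg "'p form"
  | Conj "'p form" "'p form"
  | Ign "'p form"   \<comment> \<open>the operator \<open>I\<close>\<close>
  | IgnR "'p form"  \<comment> \<open>the operator \<open>I\<^sup>R\<close>\<close>

definition Imp :: "'p form \<Rightarrow> 'p form \<Rightarrow> 'p form" where
  "Imp \<phi> \<psi> = Neg (Conj \<phi> (Neg \<psi>))"

definition Iff :: "'p form \<Rightarrow> 'p form \<Rightarrow> 'p form" where
  "Iff \<phi> \<psi> = Conj (Imp \<phi> \<psi>) (Imp \<psi> \<phi>)"

text \<open>The fragment \<open>\<L>(I)\<close> over the set \<open>P\<close> of propositional variables.\<close>

inductive_set L_I :: "'p set \<Rightarrow> 'p form set" for P :: "'p set" where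
  Atom: "p \<in> P \<Longrightarrow> Atom p \<in> L_I P"
| Neg: "\<phi> \<in> L_I P \<Longrightarrow> Neg \<phi> \<in> L_I P"
| Conj: "\<phi> \<in> L_I P \<Longrightarrow> \<psi> \<in> L_I P \<Longrightarrow> Conj \<phi> \<psi> \<in> L_I P"
| Ign: "\<phi> \<in> L_I P \<Longrightarrow> Ign \<phi> \<in> L_I P"

record 's biframe =
  states :: "'s set"
  rel :: "('s \<times> 's) set"
  brel :: "('s \<times> 's) set"  \<comment> \<open>the relation \<open>R\<^sup>\<bullet>\<close>\<close>

record ('s, 'p) bimodel = "'s biframe" +
  val :: "'p \<Rightarrow> 's set"

definition is_biframe :: "('s, 'm) biframe_scheme \<Rightarrow> bool" where
  "is_biframe F \<longleftrightarrow>
     states F \<noteq> {} \<and> rel F \<subseteq> states F \<times> states F \<and> brel F \<subseteq> states F \<times> states F"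

text \<open>Only the values of the valuation on \<open>P\<close> matter for formulas over \<open>P\<close>, so nothing
  is required of it elsewhere.\<close>

definition is_bimodel :: "'p set \<Rightarrow> ('s, 'p) bimodel \<Rightarrow> bool" where
  "is_bimodel P M \<longleftrightarrow> is_biframe M \<and> (\<forall>p\<in>P. val M p \<subseteq> states M)"

text \<open>Since the relations of a bi-frame are contained in \<open>states M \<times> states M\<close>, the
  quantifiers over successors need no further relativisation.\<close>

primrec sat :: "('s, 'p) bimodel \<Rightarrow> 's \<Rightarrow> 'p form \<Rightarrow> bool" where
  "sat M s (Atom p) \<longleftrightarrow> s \<in> val M p"
| "sat M s (Neg \<phi>) \<longleftrightarrow> \<not> sat M s \<phi>"
| "sat M s (Conj \<phi> \<psi>) \<longleftrightarrow> sat M s \<phi> \<and> sat M s \<psi>"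
| "sat M s (Ign \<phi>) \<longleftrightarrow>
     (\<exists>t. (s, t) \<in> rel M \<and> sat M t \<phi>) \<and> (\<exists>u. (s, u) \<in> rel M \<and> \<not> sat M u \<phi>)"
| "sat M s (IgnR \<phi>) \<longleftrightarrow>
     ((\<exists>t. (s, t) \<in> rel M \<and> sat M t \<phi>) \<and> (\<exists>u. (s, u) \<in> rel M \<and> \<not> sat M u \<phi>)) \<and>
     (\<exists>t. (s, t) \<in> brel M \<and>
        \<not> ((\<exists>v. (t, v) \<in> rel M \<and> sat M v \<phi>) \<and> (\<exists>u. (t, u) \<in> rel M \<and> \<not> sat M u \<phi>)))"

text \<open>The \<open>IgnR\<close> clause above is unfolded only to make the recursion primitive.\<close>

lemma sat_IgnR_iff:
  "sat M s (IgnR \<phi>) \<longleftrightarrow>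
     sat M s (Ign \<phi>) \<and> (\<exists>t. (s, t) \<in> brel M \<and> \<not> sat M t (Ign \<phi>))"
  by simp

text \<open>\<open>biframe.truncate M\<close> is the bi-frame on which \<open>M\<close> is based.
  The class \<open>K\<close> consists of bi-frames with carrier inside the type \<open>'s\<close>. For infinite \<open>'s\<close>
  this is no restriction for elementary classes such as the one defined by \<open>R\<^sup>\<bullet> \<subseteq> R\<close>: by
  downward Loewenheim-Skolem, a biconditional that fails on some such bi-model fails on a
  countable one.\<close>

definition IgnR_definable :: "'p set \<Rightarrow> 's biframe set \<Rightarrow> bool" where
  "IgnR_definable P K \<longleftrightarrow>
     (\<forall>\<phi>\<in>L_I P. \<exists>\<psi>\<in>L_I P. \<forall>M :: ('s, 'p) bimodel.
        is_bimodel P M \<and> biframe.truncate M \<in> K \<longrightarrow>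
        (\<forall>s\<in>states M. sat M s (Iff (IgnR \<phi>) \<psi>)))"

end

(* Formulas of L(I) do not see the second relation, so it suffices to have two bi-models that
   differ only in the second relation and disagree on I^R p at some state. *)
theory Submission
  imports Defs
begin

text \<open>Only the clause for \<open>IgnR\<close> reads \<open>brel\<close>, so changing
  \<open>brel\<close> alone preserves the truth of every formula of \<open>L_I P\<close>. A
  \<open>\<psi>\<close> defining \<open>IgnR (Atom p)\<close> would thus force its truth value to
  survive such a change within the class, which a two-state example refutes.\<close>

lemma L_I_sat_brel_update:
  assumes "\<phi> \<in> L_I P"
  shows "sat (M\<lparr>brel := B\<rparr>) s \<phi> \<longleftrightarrow> sat M s \<phi>"
  using assms by (induction arbitrary: s rule: L_I.induct) auto

lemma sat_Iff: "sat M s (Iff \<phi> \<psi>) \<longleftrightarrow> (sat M s \<phi> \<longleftrightarrow> sat M s \<psi>)"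
  by (auto simp: Iff_def Imp_def)

theorem proposition9:
  fixes P :: "'p set"
  assumes "P \<noteq> {}"
    and "infinite (UNIV :: 's set)"
  shows "\<not> IgnR_definable P {F :: 's biframe. is_biframe F \<and> brel F \<subseteq> rel F}"
    (is "\<not> IgnR_definable P ?K")
proof
  assume def: "IgnR_definable P ?K"
  obtain p where p: "p \<in> P"
    using assms(1) by blast
  obtain a b :: 's where ab: "a \<noteq> b"
    using assms(2) by (metis (full_types) finite.simps UNIV_eq_I insertI1)
  \<comment> \<open>At \<open>a\<close>, \<open>Ign (Atom p)\<close> holds, with \<open>b\<close>
    the successor satisfying \<open>p\<close> and \<open>a\<close> the one refuting it; at the dead
    end \<open>b\<close> it fails.\<close>
  define M :: "('s, 'p) bimodel" where
    "M = \<lparr>states = {a, b}, rel = {(a, a), (a, b)}, brel = {}, val = \<lambda>_. {b}\<rparr>"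
  \<comment> \<open>The new pair makes \<open>b\<close> the witness that
    \<open>IgnR (Atom p)\<close> needs at \<open>a\<close>; it already lies in \<open>rel\<close>,
    so the frame stays in the class.\<close>
  define M' where "M' = M\<lparr>brel := {(a, b)}\<rparr>"
  obtain \<psi> where \<psi>: "\<psi> \<in> L_I P"
    and equiv: "\<And>N :: ('s, 'p) bimodel. is_bimodel P N \<Longrightarrow> biframe.truncate N \<in> ?K \<Longrightarrow>
      \<forall>s\<in>states N. sat N s (Iff (IgnR (Atom p)) \<psi>)"
    using def L_I.Atom[OF p] unfolding IgnR_definable_def by meson
  have "sat M a (IgnR (Atom p)) \<longleftrightarrow> sat M a \<psi>"
    using equiv[of M]
    by (simp add: M_def is_bimodel_def is_biframe_def biframe.defs sat_Iff del: sat.simps)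
  moreover have "sat M' a (IgnR (Atom p)) \<longleftrightarrow> sat M' a \<psi>"
    using equiv[of M']
    by (simp add: M'_def M_def is_bimodel_def is_biframe_def biframe.defs sat_Iff del: sat.simps)
  moreover have "sat M' a \<psi> \<longleftrightarrow> sat M a \<psi>"
    unfolding M'_def by (rule L_I_sat_brel_update[OF \<psi>])
  moreover have "\<not> sat M a (IgnR (Atom p))"
    by (simp add: M_def)
  moreover have "sat M' a (IgnR (Atom p))"
    using ab by (auto simp: M'_def M_def)
  ultimately show False
    by blast
qed

end
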